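(* Let $(G,\mu,\alpha)$ be a Hom-algebra over $\mathbb{K}$ such that $\alpha$ is an automorphism of $G$, and let $(M,\psi,\gamma)$ be a right Hom-module of $(G,\mu,\alpha)$. Then, under the Sweedler duality construction, $(M^{\circ},\psi^{\circ},\gamma^{\circ})$ is a right Hom-comodule of the Hom-coalgebra $G^{\circ}$, where $\psi^{\circ}=\psi^{*}|_{M^{\circ}}$, $\gamma^{\circ}=\gamma^{*}|_{M^{\circ}}$, and $\psi^{*}:M^{*}\to(M\otimes G)^{*}$, $\gamma^*:M^*\to M^*$ are the dual maps of $\psi$ and $\gamma$.
   Context: $\mathbb{K}$ is a field of characteristic zero; all linear spaces and tensor products are over $\mathbb{K}$, and $V^*$ is the full linear dual of $V$. A Hom-algebra (Hom-associative algebra) is a triple $(G,\mu,\alpha)$ where $G$ is a linear space, $\mu:G\otimes G\to G$, $\mu(g\otimes g')=gg'$, is a linear map and $\alpha:G\to G$ is a linear map such that $\alpha(g)(hk)=(gh)\alpha(k)$ and $\alpha(hk)=\alpha(h)\alpha(k)$ for all $g,h,k\in G$. No unit is required. That $\alpha$ is an automorphism means that it is moreover bijective. An ideal of $G$ is a subspace $H\subseteq G$ such that $\alpha(H)\subseteq H$ and $ab\in H$, $ba\in H$ for all $a\in G$, $b\in H$. It is finite-codimensional if $\dim(G/H)<\infty$. A right Hom-module of $(G,\mu,\alpha)$ is a triple $(M,\psi,\gamma)$ where $M$ is a linear space and $\psi:M\otimes G\to M$, $\psi(m\otimes g)=m\cdot g$, and $\gamma:M\to M$ are linear maps with $\psi\circ(\psi\otimes\alpha)=\psi\circ(\gamma\otimes\mu)$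 and $\psi\circ(\gamma\otimes\alpha)=\gamma\circ\psi$. A Hom-coalgebra is a triple $(C,\Delta,\beta)$ where $C$ is a linear space and $\Delta:C\to C\otimes C$, $\beta:C\to C$ are linear maps with $(\beta\otimes\Delta)\circ\Delta=(\Delta\otimes\beta)\circ\Delta$ and $\Delta\circ\beta=(\beta\otimes\beta)\circ\Delta$. No counit is required. A right Hom-comodule of $(C,\Delta,\beta)$ is a triple $(A,\phi,\epsilon)$ where $A$ is a linear space and $\phi:A\to A\otimes C$, $\epsilon:A\to A$ are linear maps with $(\phi\otimes\beta)\circ\phi=(\epsilon\otimes\Delta)\circ\phi$ and $(\epsilon\otimes\beta)\circ\phi=\phi\circ\epsilon$. Sweedler dualities: $G^{\circ}=\{f\in G^*\mid \operatorname{Ker} f\supseteq J \text{ for some finite-codimensional ideal } J \text{ of } G\}$, and $M^{\circ}=\{f\in M^*\mid f(M\cdot I)=0 \text{ for some finite-codimensional ideal } I \text{ of } G\}$, where $M\cdot I$ is the span of all $m\cdot a$ with $m\in M$, $a\in I$. $G^{\circ}$ is the Hom-coalgebra $(G^{\circ},\Delta,\alpha^{\circ})$ with $\Delta=\mu^*|_{G^{\circ}}$, $\alpha^{\circ}=\alpha^*|_{G^{\circ}}$, where $\langle\mu^*(f),x\otimes y\rangle=\langle f,\mu(x\otimes y)\rangle$ and $\alpha^*(f)=f\circ\alpha$. The dual maps of the module are $\langle\psi^*(\xi),m\otimes g\rangle=\langle\xi,\psi(m\otimes g)\rangle$ and $\gamma^*(\xi)=\xi\circ\gamma$. The spaces $G^{\circ}\otimes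 G^{\circ}$ and $M^{\circ}\otimes G^{\circ}$ are regarded as subspaces of $(G\otimes G)^*$ and $(M\otimes G)^*$ via $(f\otimes g)(x\otimes y)=f(x)g(y)$. The assertion includes that $\psi^*(M^{\circ})\subseteq M^{\circ}\otimes G^{\circ}$ and $\gamma^*(M^{\circ})\subseteq M^{\circ}$. *)

theory Defs
  imports Complex_Main "HOL-Library.Function_Algebras"
begin

section \<open>Spaces of scalar functions and their tensor products\<close>

text \<open>
  Duals and the spaces built from them are carried by subspaces of \<^typ>\<open>'x \<Rightarrow> 'k\<close> with the
  pointwise operations.  Every linear space over \<^typ>\<open>'k\<close> is isomorphic to such a subspace.
\<close>

definition fscale :: "'k::field \<Rightarrow> ('x \<Rightarrow> 'k) \<Rightarrow> 'x \<Rightarrow> 'k"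
  where "fscale c f = (\<lambda>x. c * f x)"

interpretation fs: vector_space fscale
  by standard (auto simp: fscale_def algebra_simps fun_eq_iff)

definition linear_on :: "('x \<Rightarrow> 'k::field) set \<Rightarrow> (('x \<Rightarrow> 'k) \<Rightarrow> ('y \<Rightarrow> 'k)) \<Rightarrow> bool"
  where "linear_on A T \<longleftrightarrow>
    (\<forall>f\<in>A. \<forall>g\<in>A. T (f + g) = T f + T g) \<and> (\<forall>c. \<forall>f\<in>A. T (fscale c f) = fscale c (T f))"

definition ftensor :: "('x \<Rightarrow> 'k::field) \<Rightarrow> ('y \<Rightarrow> 'k) \<Rightarrow> 'x \<times> 'y \<Rightarrow> 'k"
  where "ftensor f g = (\<lambda>(x, y). f x * g y)"

text \<open>
  The canonical map from the algebraic tensor product of \<open>A \<subseteq> 'x \<Rightarrow> 'k\<close> and \<open>B \<subseteq> 'y \<Rightarrow> 'k\<close> to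
  \<open>'x \<times> 'y \<Rightarrow> 'k\<close> is injective, and the following is its image.  That this is a tensor product is
  the universal property \<open>tensor_universal\<close> below.
\<close>

definition tensor :: "('x \<Rightarrow> 'k::field) set \<Rightarrow> ('y \<Rightarrow> 'k) set \<Rightarrow> ('x \<times> 'y \<Rightarrow> 'k) set"
  where "tensor A B = fs.span {ftensor f g | f g. f \<in> A \<and> g \<in> B}"

text \<open>
  The linear map \<open>S \<otimes> T\<close> on \<open>A \<otimes> B\<close>, for \<open>S\<close> and \<open>T\<close> linear on \<open>A\<close> and \<open>B\<close>.  Its values outside
  \<^term>\<open>tensor A B\<close> are irrelevant; on it, it exists and is unique (theorem \<open>tensor_map\<close>, lemma
  \<open>linear_on_tensor_unique\<close>).
\<close>

definition tensor_map ::
  "('x \<Rightarrow> 'k::field) set \<Rightarrow> ('y \<Rightarrow> 'k) set \<Rightarrow> (('x \<Rightarrow> 'k) \<Rightarrow> 'u \<Rightarrow> 'k) \<Rightarrow> (('y \<Rightarrow> 'k) \<Rightarrow> 'v \<Rightarrow> 'k)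
    \<Rightarrow> ('x \<times> 'y \<Rightarrow> 'k) \<Rightarrow> 'u \<times> 'v \<Rightarrow> 'k"
  where "tensor_map A B S T =
    (SOME F. linear_on (tensor A B) F \<and>
      (\<forall>f\<in>A. \<forall>g\<in>B. F (ftensor f g) = ftensor (S f) (T g)))"

text \<open>The canonical identification of \<open>A \<otimes> (B \<otimes> C)\<close> with \<open>(A \<otimes> B) \<otimes> C\<close>.\<close>

definition tensor_assoc :: "('x \<times> ('y \<times> 'z) \<Rightarrow> 'k) \<Rightarrow> ('x \<times> 'y) \<times> 'z \<Rightarrow> 'k"
  where "tensor_assoc t = (\<lambda>((x, y), z). t (x, (y, z)))"

lemma tensor_subspace: "fs.subspace (tensor A B)"
  by (simp add: tensor_def)

lemma ftensor_in_tensor: "f \<in> A \<Longrightarrow> g \<in> B \<Longrightarrow> ftensor f g \<in> tensor A B"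
  unfolding tensor_def by (rule fs.span_base) blast

lemma linear_onI_linear:
  assumes "Vector_Spaces.linear fscale fscale F" shows "linear_on A F"
proof -
  interpret Vector_Spaces.linear fscale fscale F by fact
  show ?thesis by (simp add: linear_on_def add scale)
qed

lemma linear_on_0: "linear_on A F \<Longrightarrow> 0 \<in> A \<Longrightarrow> F 0 = 0"
  unfolding linear_on_def by (metis fs.scale_zero_left)

lemma linear_on_tensor_unique:
  assumes "linear_on (tensor A B) F" "linear_on (tensor A B) F'"
    and "\<And>f g. f \<in> A \<Longrightarrow> g \<in> B \<Longrightarrow> F (ftensor f g) = F' (ftensor f g)"
    and "t \<in> tensor A B"
  shows "F t = F' t"
proof -
  have "t \<in> fs.span {ftensor f g | f g. f \<in> A \<and> g \<in> B}"
    using assms(4) by (simp add: tensor_def)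
  then have "t \<in> tensor A B \<and> F t = F' t"
  proof (induction rule: fs.span_induct_alt)
    case base
    show ?case
      using linear_on_0[OF assms(1)] linear_on_0[OF assms(2)] fs.subspace_0[OF tensor_subspace]
      by metis
  next
    case (step c x y)
    then obtain f g where x: "x = ftensor f g" "f \<in> A" "g \<in> B" by blast
    have xt: "x \<in> tensor A B" using x ftensor_in_tensor by blast
    have cx: "fscale c x \<in> tensor A B" using fs.subspace_scale[OF tensor_subspace xt] .
    have "F (fscale c x + y) = fscale c (F x) + F y" "F' (fscale c x + y) = fscale c (F' x) + F' y"
      using assms(1,2) step xt cx unfolding linear_on_def by metis+
    moreover have "F x = F' x" using x assms(3) by blast
    moreover have "fscale c x + y \<in> tensor A B"
      using step cx fs.subspace_add[OF tensor_subspace] by blast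
    ultimately show ?case using step by metis
  qed
  then show ?thesis by blast
qed

lemma sum_fun_apply: "(\<Sum>i\<in>I. h i) x = (\<Sum>i\<in>I. h i x)"
  for h :: "'i \<Rightarrow> 'x \<Rightarrow> 'k::field"
  by (induction I rule: infinite_finite_induct) auto

lemma ftensor_coeffs_zero:
  assumes E: "fs.independent E" "finite E'" "E' \<subseteq> E"
    and D: "fs.independent D" "finite D'" "D' \<subseteq> D"
    and 0: "(\<Sum>p\<in>E' \<times> D'. fscale (c p) (ftensor (fst p) (snd p))) = 0"
    and p: "e \<in> E'" "d \<in> D'"
  shows "c (e, d) = 0"
proof -
  have zero: "(\<Sum>e\<in>E'. \<Sum>d\<in>D'. c (e, d) * (e x * d y)) = 0" for x y
  proof -
    have "(\<Sum>p\<in>E' \<times> D'. fscale (c p) (ftensor (fst p) (snd p))) (x, y) = 0"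
      by (simp add: 0)
    then show ?thesis
      by (simp add: sum_fun_apply fscale_def ftensor_def sum.cartesian_product case_prod_unfold)
  qed
  have row: "(\<Sum>d\<in>D'. c (e, d) * d y) = 0" for y
  proof -
    have "(\<Sum>e\<in>E'. fscale (\<Sum>d\<in>D'. c (e, d) * d y) e) = 0"
    proof
      fix x
      have "(\<Sum>e\<in>E'. fscale (\<Sum>d\<in>D'. c (e, d) * d y) e) x
          = (\<Sum>e\<in>E'. \<Sum>d\<in>D'. c (e, d) * (e x * d y))"
        by (simp add: sum_fun_apply fscale_def sum_distrib_right sum_distrib_left mult_ac)
      then show "(\<Sum>e\<in>E'. fscale (\<Sum>d\<in>D'. c (e, d) * d y) e) x = 0 x"
        by (simp add: zero)
    qed
    then show ?thesis
      using E p fs.independent_explicit_finite_subsets[of E]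
      by (auto dest!: spec[of _ E'] spec[of _ "\<lambda>e. \<Sum>d\<in>D'. c (e, d) * d y"])
  qed
  have "(\<Sum>d\<in>D'. fscale (c (e, d)) d) = 0"
    by (rule ext) (simp add: sum_fun_apply fscale_def row)
  then show ?thesis
    using D p fs.independent_explicit_finite_subsets[of D]
    by (auto dest!: spec[of _ D'] spec[of _ "\<lambda>d. c (e, d)"])
qed

lemma ftensor_coeffs_zero':
  assumes E: "fs.independent E" and D: "fs.independent D"
    and S: "finite S" "S \<subseteq> E \<times> D"
    and 0: "(\<Sum>p\<in>S. fscale (c p) (ftensor (fst p) (snd p))) = 0" and p: "p \<in> S"
  shows "c p = 0"
proof -
  let ?c = "\<lambda>p. if p \<in> S then c p else 0"
  have sub: "S \<subseteq> fst ` S \<times> snd ` S" by force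
  have "(\<Sum>p\<in>fst ` S \<times> snd ` S. fscale (?c p) (ftensor (fst p) (snd p)))
      = (\<Sum>p\<in>S. fscale (?c p) (ftensor (fst p) (snd p)))"
    using S sub by (intro sum.mono_neutral_right) (auto simp: fscale_def fun_eq_iff)
  also have "\<dots> = 0"
    using 0 by (simp cong: sum.cong)
  finally have "?c (fst p, snd p) = 0"
    using S p by (intro ftensor_coeffs_zero[OF E _ _ D, of "fst ` S" "snd ` S"]) auto
  then show ?thesis using p by simp
qed

lemma ftensor_basis:
  fixes E :: "('a \<Rightarrow> 'b::field) set" and D :: "('c \<Rightarrow> 'b) set"
  assumes E: "fs.independent E" and D: "fs.independent D"
  shows "inj_on (\<lambda>p. ftensor (fst p) (snd p)) (E \<times> D)"
    and "fs.independent ((\<lambda>p. ftensor (fst p) (snd p)) ` (E \<times> D))"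
proof -
  let ?t = "\<lambda>p. ftensor (fst p) (snd p)"
  show inj: "inj_on ?t (E \<times> D)"
  proof (rule inj_onI, rule ccontr)
    fix p q assume pq: "p \<in> E \<times> D" "q \<in> E \<times> D" "?t p = ?t q" "p \<noteq> q"
    let ?c = "\<lambda>r. if r = p then 1 else - 1 :: 'b"
    have "(\<Sum>r\<in>{p, q}. fscale (?c r) (?t r)) = 0"
      using pq by (simp add: fscale_def fun_eq_iff)
    then have "?c p = 0"
      using pq ftensor_coeffs_zero'[OF E D, of "{p, q}" ?c p] by simp
    then show False by simp
  qed
  show "fs.independent (?t ` (E \<times> D))"
    unfolding fs.independent_explicit_finite_subsets
  proof (intro allI impI ballI)
    fix T u v
    assume T: "T \<subseteq> ?t ` (E \<times> D)" "finite T" "(\<Sum>v\<in>T. fscale (u v) v) = 0" "v \<in> T"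
    obtain S where S: "S \<subseteq> E \<times> D" "finite S" "T = ?t ` S"
      using T by (meson finite_subset_image)
    have injS: "inj_on ?t S" using inj S inj_on_subset by blast
    have "(\<Sum>p\<in>S. fscale (u (?t p)) (?t p)) = 0"
      using T(3) S(3) sum.reindex[OF injS, of "\<lambda>v. fscale (u v) v"] by (simp add: o_def)
    moreover obtain p where "p \<in> S" "v = ?t p" using T(4) S(3) by blast
    ultimately show "u v = 0"
      using ftensor_coeffs_zero'[OF E D S(2,1), of "\<lambda>p. u (?t p)" p] by simp
  qed
qed

theorem tensor_universal:
  fixes A :: "('x \<Rightarrow> 'k::field) set" and B :: "('y \<Rightarrow> 'k) set"
    and s :: "'k \<Rightarrow> 'w::ab_group_add \<Rightarrow> 'w"
  assumes A: "fs.subspace A" and B: "fs.subspace B" and s: "vector_space s"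
    and P1: "\<And>f f' g. f \<in> A \<Longrightarrow> f' \<in> A \<Longrightarrow> g \<in> B \<Longrightarrow> P (f + f') g = P f g + P f' g"
    and P2: "\<And>c f g. f \<in> A \<Longrightarrow> g \<in> B \<Longrightarrow> P (fscale c f) g = s c (P f g)"
    and P3: "\<And>f g g'. f \<in> A \<Longrightarrow> g \<in> B \<Longrightarrow> g' \<in> B \<Longrightarrow> P f (g + g') = P f g + P f g'"
    and P4: "\<And>c f g. f \<in> A \<Longrightarrow> g \<in> B \<Longrightarrow> P f (fscale c g) = s c (P f g)"
  shows "\<exists>F. Vector_Spaces.linear fscale s F \<and> (\<forall>f\<in>A. \<forall>g\<in>B. F (ftensor f g) = P f g)"
proof -
  interpret W: vector_space s by fact
  interpret pair: vector_space_pair "fscale :: 'k \<Rightarrow> ('x \<times> 'y \<Rightarrow> 'k) \<Rightarrow> _" s ..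
  let ?t = "\<lambda>p. ftensor (fst p) (snd p)"
  obtain E where E: "E \<subseteq> A" "fs.independent E" "A \<subseteq> fs.span E"
    using fs.maximal_independent_subset by blast
  obtain D where D: "D \<subseteq> B" "fs.independent D" "B \<subseteq> fs.span D"
    using fs.maximal_independent_subset by blast
  define Q where "Q t = (let p = the_inv_into (E \<times> D) ?t t in P (fst p) (snd p))" for t
  define F where "F = pair.construct (?t ` (E \<times> D)) Q"
  have lin: "Vector_Spaces.linear fscale s F"
    unfolding F_def by (rule pair.linear_construct[OF ftensor_basis(2)[OF E(2) D(2)]])
  interpret F: Vector_Spaces.linear fscale s F by (rule lin)
  have ED: "F (ftensor e d) = P e d" if "e \<in> E" "d \<in> D" for e d
  proof -
    have "ftensor e d = ?t (e, d)" by simp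
    moreover have "the_inv_into (E \<times> D) ?t (?t (e, d)) = (e, d)"
      using ftensor_basis(1)[OF E(2) D(2)] that by (intro the_inv_into_f_f) auto
    moreover have "F (?t (e, d)) = Q (?t (e, d))"
      unfolding F_def using that by (intro pair.construct_basis ftensor_basis(2) E(2) D(2)) blast
    ultimately show ?thesis by (simp add: Q_def)
  qed
  have tl: "ftensor (fscale c f + f') g = fscale c (ftensor f g) + ftensor f' g"
    and tr: "ftensor h (fscale c g + g') = fscale c (ftensor h g) + ftensor h g'"
    for c and f f' h :: "'x \<Rightarrow> 'k" and g g' :: "'y \<Rightarrow> 'k"
    by (auto simp: ftensor_def fscale_def fun_eq_iff algebra_simps)
  have A0: "0 \<in> A" and B0: "0 \<in> B" using A B fs.subspace_0 by blast+
  have t0: "ftensor f 0 = 0" "ftensor 0 g = 0" for f :: "'x \<Rightarrow> 'k" and g :: "'y \<Rightarrow> 'k"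
    by (auto simp: ftensor_def fun_eq_iff)
  have P0: "P f 0 = 0" if "f \<in> A" for f
    using P4[OF that B0, of 0] by (metis W.scale_zero_left fs.scale_zero_left)
  have P0': "P 0 g = 0" if "g \<in> B" for g
    using P2[OF A0 that, of 0] by (metis W.scale_zero_left fs.scale_zero_left)
  have EB: "g \<in> B \<and> F (ftensor e g) = P e g" if e: "e \<in> E" and "g \<in> fs.span D" for e g
    using that(2)
  proof (induction rule: fs.span_induct_alt)
    case base
    show ?case using B0 P0 E(1) e t0 F.zero by (metis subsetD)
  next
    case (step c x y)
    have "x \<in> B" "e \<in> A" using step D e E by auto
    moreover have "fscale c x \<in> B" using \<open>x \<in> B\<close> B fs.subspace_scale by blast
    ultimately have "P e (fscale c x + y) = s c (P e x) + P e y" and "fscale c x + y \<in> B"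
      using step P3 P4 fs.subspace_add[OF B] by simp_all
    moreover have "F (ftensor e (fscale c x + y)) = s c (F (ftensor e x)) + F (ftensor e y)"
      unfolding tr F.add F.scale ..
    moreover have "F (ftensor e x) = P e x" using ED[OF e] step by simp
    ultimately show ?case using step by metis
  qed
  have "f \<in> A \<and> F (ftensor f g) = P f g" if g: "g \<in> B" and "f \<in> fs.span E" for f g
    using that(2)
  proof (induction rule: fs.span_induct_alt)
    case base
    show ?case using A0 P0' g t0 F.zero by metis
  next
    case (step c x y)
    have "x \<in> A" using step E by auto
    moreover have "fscale c x \<in> A" using \<open>x \<in> A\<close> A fs.subspace_scale by blast
    moreover have "F (ftensor x g) = P x g" using EB step g D by blast
    ultimately have "P (fscale c x + y) g = s c (F (ftensor x g)) + P y g"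
      and "fscale c x + y \<in> A"
      using step g P1 P2 fs.subspace_add[OF A] by simp_all
    moreover have "F (ftensor (fscale c x + y) g) = s c (F (ftensor x g)) + F (ftensor y g)"
      unfolding tl F.add F.scale ..
    ultimately show ?case using step by metis
  qed
  then show ?thesis using lin E(3) by blast
qed

theorem tensor_map:
  fixes A :: "('x \<Rightarrow> 'k::field) set" and B :: "('y \<Rightarrow> 'k) set"
    and S :: "('x \<Rightarrow> 'k) \<Rightarrow> 'u \<Rightarrow> 'k" and T :: "('y \<Rightarrow> 'k) \<Rightarrow> 'v \<Rightarrow> 'k"
  assumes A: "fs.subspace A" "linear_on A S" and B: "fs.subspace B" "linear_on B T"
  shows "linear_on (tensor A B) (tensor_map A B S T)"
    and "\<And>f g. f \<in> A \<Longrightarrow> g \<in> B \<Longrightarrow>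
           tensor_map A B S T (ftensor f g) = ftensor (S f) (T g)"
proof -
  have t: "ftensor (f + f') g = ftensor f g + ftensor f' g"
    "ftensor f (g + g') = ftensor f g + ftensor f g'"
    "ftensor (fscale c f) g = fscale c (ftensor f g)"
    "ftensor f (fscale c g) = fscale c (ftensor f g)"
    for c :: 'k and f f' :: "'p \<Rightarrow> 'k" and g g' :: "'q \<Rightarrow> 'k"
    by (auto simp: ftensor_def fscale_def fun_eq_iff algebra_simps)
  have "\<exists>F. Vector_Spaces.linear fscale fscale F \<and>
      (\<forall>f\<in>A. \<forall>g\<in>B. F (ftensor f g) = ftensor (S f) (T g))"
    by (rule tensor_universal[OF A(1) B(1) fs.vector_space_axioms])
       (use A(2) B(2) in \<open>auto simp: linear_on_def t\<close>)
  then have "\<exists>F. linear_on (tensor A B) F \<and>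
      (\<forall>f\<in>A. \<forall>g\<in>B. F (ftensor f g) = ftensor (S f) (T g))"
    using linear_onI_linear by blast
  note * = someI_ex[OF this, folded tensor_map_def]
  show "linear_on (tensor A B) (tensor_map A B S T)" using * by blast
  show "\<And>f g. f \<in> A \<Longrightarrow> g \<in> B \<Longrightarrow>
      tensor_map A B S T (ftensor f g) = ftensor (S f) (T g)" using * by blast
qed


section \<open>Hom-algebras and Hom-modules\<close>

text \<open>
  A linear map out of a tensor product \<open>V \<otimes> W\<close> of abstract linear spaces is given as the
  corresponding bilinear map \<open>V \<Rightarrow> W \<Rightarrow> U\<close>.
\<close>

locale hom_algebra = vector_space scale
  for scale :: "'k::field \<Rightarrow> 'g::ab_group_add \<Rightarrow> 'g" +
  fixes mult :: "'g \<Rightarrow> 'g \<Rightarrow> 'g" and twist :: "'g \<Rightarrow> 'g"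
  assumes mult_linear_right: "Vector_Spaces.linear scale scale (mult g)"
    and mult_linear_left: "Vector_Spaces.linear scale scale (\<lambda>g. mult g h)"
    and twist_linear: "Vector_Spaces.linear scale scale twist"
    and hom_assoc: "mult (twist g) (mult h k) = mult (mult g h) (twist k)"
    and twist_mult: "twist (mult h k) = mult (twist h) (twist k)"

definition hom_ideal ::
  "('k::field \<Rightarrow> 'g::ab_group_add \<Rightarrow> 'g) \<Rightarrow> ('g \<Rightarrow> 'g \<Rightarrow> 'g) \<Rightarrow> ('g \<Rightarrow> 'g) \<Rightarrow> 'g set \<Rightarrow> bool"
  where "hom_ideal scale mult twist H \<longleftrightarrow>
    module.subspace scale H \<and> twist ` H \<subseteq> H \<and>
    (\<forall>a. \<forall>b\<in>H. mult a b \<in> H \<and> mult b a \<in> H)"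

definition coset :: "'g::ab_group_add set \<Rightarrow> 'g \<Rightarrow> 'g set"
  where "coset H x = {x + h | h. h \<in> H}"

text \<open>
  The quotient \<open>G/H\<close> is \<^term>\<open>range (coset H)\<close>, and the cosets of the elements of
  \<^term>\<open>module.span scale B\<close> form the span in \<open>G/H\<close> of the cosets of the elements of \<open>B\<close>.
\<close>

definition finite_codim :: "('k::field \<Rightarrow> 'g::ab_group_add \<Rightarrow> 'g) \<Rightarrow> 'g set \<Rightarrow> bool"
  where "finite_codim scale H \<longleftrightarrow>
    (\<exists>B. finite B \<and> range (coset H) = coset H ` module.span scale B)"

locale right_hom_module =
  hom_algebra scaleG mult twist + M: vector_space scaleM
  for scaleG :: "'k::field \<Rightarrow> 'g::ab_group_add \<Rightarrow> 'g" and mult twist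
    and scaleM :: "'k \<Rightarrow> 'm::ab_group_add \<Rightarrow> 'm" +
  fixes act :: "'m \<Rightarrow> 'g \<Rightarrow> 'm" and twistM :: "'m \<Rightarrow> 'm"
  assumes act_linear_right: "Vector_Spaces.linear scaleG scaleM (act m)"
    and act_linear_left: "Vector_Spaces.linear scaleM scaleM (\<lambda>m. act m g)"
    and twistM_linear: "Vector_Spaces.linear scaleM scaleM twistM"
    and act_assoc: "act (act m g) (twist h) = act (twistM m) (mult g h)"
    and act_twist: "act (twistM m) (twist g) = twistM (act m g)"


section \<open>Hom-coalgebras and Hom-comodules\<close>

locale hom_coalgebra =
  fixes C :: "('x \<Rightarrow> 'k::field) set"
    and comult :: "('x \<Rightarrow> 'k) \<Rightarrow> 'x \<times> 'x \<Rightarrow> 'k"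
    and cotwist :: "('x \<Rightarrow> 'k) \<Rightarrow> 'x \<Rightarrow> 'k"
  assumes C_subspace: "fs.subspace C"
    and comult_linear: "linear_on C comult"
    and comult_in: "comult ` C \<subseteq> tensor C C"
    and cotwist_linear: "linear_on C cotwist"
    and cotwist_in: "cotwist ` C \<subseteq> C"
    and hom_coassoc: "c \<in> C \<Longrightarrow>
      tensor_assoc (tensor_map C C cotwist comult (comult c)) =
      tensor_map C C comult cotwist (comult c)"
    and cotwist_comult: "c \<in> C \<Longrightarrow>
      comult (cotwist c) = tensor_map C C cotwist cotwist (comult c)"

locale right_hom_comodule = hom_coalgebra C comult cotwist
  for C :: "('x \<Rightarrow> 'k::field) set" and comult cotwist +
  fixes A :: "('y \<Rightarrow> 'k) set"
    and coact :: "('y \<Rightarrow> 'k) \<Rightarrow> 'y \<times> 'x \<Rightarrow> 'k"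
    and cotwistA :: "('y \<Rightarrow> 'k) \<Rightarrow> 'y \<Rightarrow> 'k"
  assumes A_subspace: "fs.subspace A"
    and coact_linear: "linear_on A coact"
    and coact_in: "coact ` A \<subseteq> tensor A C"
    and cotwistA_linear: "linear_on A cotwistA"
    and cotwistA_in: "cotwistA ` A \<subseteq> A"
    and coact_coassoc: "a \<in> A \<Longrightarrow>
      tensor_map A C coact cotwist (coact a) =
      tensor_assoc (tensor_map A C cotwistA comult (coact a))"
    and coact_cotwist: "a \<in> A \<Longrightarrow>
      tensor_map A C cotwistA cotwist (coact a) = coact (cotwistA a)"


section \<open>Sweedler duals\<close>

definition dual :: "('k::field \<Rightarrow> 'v::ab_group_add \<Rightarrow> 'v) \<Rightarrow> ('v \<Rightarrow> 'k) set"
  where "dual scale = {f. Vector_Spaces.linear scale (*) f}"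

text \<open>
  A bilinear map \<open>b : V \<times> W \<rightarrow> U\<close> is dualised as \<^term>\<open>dual_map (case_prod b)\<close>, where an element of
  \<open>(V \<otimes> W)\<^sup>*\<close> is identified with the bilinear form on \<open>V \<times> W\<close> that it induces.
\<close>

definition dual_map :: "('v \<Rightarrow> 'u) \<Rightarrow> ('u \<Rightarrow> 'k) \<Rightarrow> 'v \<Rightarrow> 'k"
  where "dual_map T f = f \<circ> T"

definition sweedler_dual ::
  "('k::field \<Rightarrow> 'g::ab_group_add \<Rightarrow> 'g) \<Rightarrow> ('g \<Rightarrow> 'g \<Rightarrow> 'g) \<Rightarrow> ('g \<Rightarrow> 'g) \<Rightarrow> ('g \<Rightarrow> 'k) set"
  where "sweedler_dual scale mult twist =
    {f \<in> dual scale. \<exists>J. hom_ideal scale mult twist J \<and> finite_codim scale J \<and> J \<subseteq> {x. f x = 0}}"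

definition sweedler_dual_module ::
  "('k::field \<Rightarrow> 'g::ab_group_add \<Rightarrow> 'g) \<Rightarrow> ('g \<Rightarrow> 'g \<Rightarrow> 'g) \<Rightarrow> ('g \<Rightarrow> 'g)
    \<Rightarrow> ('k \<Rightarrow> 'm::ab_group_add \<Rightarrow> 'm) \<Rightarrow> ('m \<Rightarrow> 'g \<Rightarrow> 'm) \<Rightarrow> ('m \<Rightarrow> 'k) set"
  where "sweedler_dual_module scaleG mult twist scaleM act =
    {f \<in> dual scaleM. \<exists>I. hom_ideal scaleG mult twist I \<and> finite_codim scaleG I \<and>
      (\<forall>x \<in> module.span scaleM {act m a | m a. a \<in> I}. f x = 0)}"

end

theory Submission
  imports Defs
begin

text \<open>
  Let \<open>f \<in> M\<degree>\<close> vanish on \<open>M \<cdot> I\<close>, and let \<open>b\<^sub>1, \<dots>, b\<^sub>n\<close> be a basis of \<open>G\<close> modulo \<open>I\<close> with dual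
  coordinates \<open>c\<^sub>i \<in> G\<degree>\<close>.  Then \<open>f (m \<cdot> g) = \<Sum>\<^sub>i f (m \<cdot> b\<^sub>i) c\<^sub>i(g)\<close>.  As \<open>\<alpha>\<close> is surjective,
  \<open>b\<^sub>i = \<alpha> h\<close> for some \<open>h\<close>, so for \<open>a \<in> I\<close> we get
  \<open>(m \<cdot> a) \<cdot> b\<^sub>i = \<gamma> m \<cdot> (a h) \<in> M \<cdot> I\<close>; hence \<open>m \<mapsto> f (m \<cdot> b\<^sub>i)\<close> lies in \<open>M\<degree>\<close> and \<open>\<psi>\<^sup>*(f)\<close> lies in
  \<open>M\<degree> \<otimes> G\<degree>\<close>.  On tensor products, tensor products of dual maps are precomposition with the
  product map, so the comodule axioms are the duals of the module axioms.
\<close>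

section \<open>Dual maps and their tensor products\<close>

lemma linear_on_dual_map: "linear_on A (dual_map T)"
  by (auto simp: linear_on_def dual_map_def fscale_def fun_eq_iff)

text \<open>Both sides are linear on the tensor product and agree on pure tensors. This replaces the
  choice in \<open>tensor_map\<close> by an explicit precomposition, so that equations between
  tensor maps can be checked pointwise.\<close>

lemma tensor_map_dual_map:
  assumes "fs.subspace A" "fs.subspace B" "t \<in> tensor A B"
  shows "tensor_map A B (dual_map S) (dual_map T) t = dual_map (map_prod S T) t"
proof (rule linear_on_tensor_unique[OF _ linear_on_dual_map _ assms(3)])
  show "linear_on (tensor A B) (tensor_map A B (dual_map S) (dual_map T))"
    by (rule tensor_map(1)) (simp_all add: assms linear_on_dual_map)
next
  fix f g assume "f \<in> A" "g \<in> B"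
  then have "tensor_map A B (dual_map S) (dual_map T) (ftensor f g)
      = ftensor (dual_map S f) (dual_map T g)"
    by (intro tensor_map(2)) (simp_all add: assms linear_on_dual_map)
  then show "tensor_map A B (dual_map S) (dual_map T) (ftensor f g)
      = dual_map (map_prod S T) (ftensor f g)"
    by (auto simp: ftensor_def dual_map_def fun_eq_iff)
qed

section \<open>Linear functionals on a linear space\<close>

lemma (in vector_space) dual_iff:
  "f \<in> dual scale \<longleftrightarrow> (\<forall>x y. f (x + y) = f x + f y) \<and> (\<forall>c x. f (scale c x) = c * f x)"
proof -
  interpret K: vector_space "(*) :: 'a \<Rightarrow> 'a \<Rightarrow> 'a"
    by standard (auto simp: algebra_simps)
  show ?thesis
    unfolding dual_def using vector_space_axioms K.vector_space_axioms
    by (auto simp: Vector_Spaces.linear_iff)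
qed

lemma (in vector_space) dual_subspace: "fs.subspace (dual scale)"
  by (auto simp: fs.subspace_def dual_iff fscale_def algebra_simps)

lemma (in vector_space) dual_0: "f \<in> dual scale \<Longrightarrow> f 0 = 0"
  unfolding dual_iff by (metis add_cancel_right_right)

lemma (in vector_space) dual_sum:
  "f \<in> dual scale \<Longrightarrow> f (sum h S) = (\<Sum>i\<in>S. f (h i))"
  by (induction S rule: infinite_finite_induct) (simp_all add: dual_0, simp add: dual_iff)

lemma (in vector_space) subspace_kernel_dual:
  "f \<in> dual scale \<Longrightarrow> subspace {x. f x = 0}"
  using dual_0[of f] by (auto simp: subspace_def dual_iff)

lemma (in vector_space) dual_map_in_dual:
  assumes "Vector_Spaces.linear s scale T" "f \<in> dual scale"
  shows "dual_map T f \<in> dual s"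
proof -
  interpret T: Vector_Spaces.linear s scale T by fact
  show ?thesis
    using assms(2) by (simp add: dual_iff T.vs1.dual_iff dual_map_def T.add T.scale)
qed

section \<open>Subspaces of finite codimension\<close>

lemma (in vector_space) finite_codim_iff:
  assumes "subspace I"
  shows "finite_codim scale I \<longleftrightarrow> (\<exists>B. finite B \<and> span (I \<union> B) = UNIV)"
proof -
  have coset_eq: "coset I x = coset I y \<longleftrightarrow> x - y \<in> I" for x y
  proof
    assume "coset I x = coset I y"
    moreover have "x \<in> coset I x"
      unfolding coset_def using subspace_0[OF assms] by force
    ultimately show "x - y \<in> I"
      by (auto simp: coset_def)
  next
    assume *: "x - y \<in> I"
    \<comment> \<open>One inclusion is enough: the hypothesis is symmetric in the two
      representatives because \<open>I\<close> is closed under negation.\<close>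
    have sub: "coset I u \<subseteq> coset I v" if "u - v \<in> I" for u v
    proof
      fix z assume "z \<in> coset I u"
      then obtain h where "h \<in> I" "z = u + h" by (auto simp: coset_def)
      then have "z = v + (u - v + h)" "u - v + h \<in> I"
        using that assms by (auto intro: subspace_add)
      then show "z \<in> coset I v" unfolding coset_def by blast
    qed
    have "y - x \<in> I"
      using subspace_neg[OF assms *] by simp
    then show "coset I x = coset I y"
      using sub * by blast
  qed
  \<comment> \<open>By \<open>coset_eq\<close>, \<open>B\<close> spans the quotient exactly if every
    \<open>x\<close> is a sum \<open>h + y\<close> with \<open>h\<close> in \<open>I\<close> and
    \<open>y\<close> in \<open>span B\<close>; since \<open>span I = I\<close>, these sums form
    \<open>span (I \<union> B)\<close>.\<close>
  have "range (coset I) = coset I ` span B \<longleftrightarrow> span (I \<union> B) = UNIV" for B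
  proof -
    have "range (coset I) = coset I ` span B \<longleftrightarrow> (\<forall>x. \<exists>y\<in>span B. coset I x = coset I y)"
      by blast
    also have "\<dots> \<longleftrightarrow> (\<forall>x. \<exists>y\<in>span B. \<exists>h\<in>I. x = h + y)"
      by (simp add: coset_eq diff_eq_eq Bex_def conj_commute)
        (metis add_diff_cancel_right' diff_add_cancel)
    also have "\<dots> \<longleftrightarrow> (\<forall>x. x \<in> span (I \<union> B))"
    proof -
      have "span I = I" using assms by (simp add: span_eq_iff)
      then show ?thesis unfolding span_Un by blast
    qed
    finally show ?thesis by blast
  qed
  then show ?thesis
    unfolding finite_codim_def by simp
qed

text \<open>A basis \<open>E\<close> of \<open>I\<close> is extended by vectors of a finite set
  \<open>B\<close> to a basis \<open>F\<close> of the whole space. Then \<open>F - E\<close> is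
  finite, and the coordinate functionals at its vectors annihilate \<open>I\<close>.\<close>

lemma (in vector_space) finite_codim_dual_basis:
  assumes I: "subspace I" and "finite_codim scale I"
  obtains D c where "finite D" "\<And>b. b \<in> D \<Longrightarrow> c b \<in> dual scale"
    "\<And>b x. b \<in> D \<Longrightarrow> x \<in> I \<Longrightarrow> c b x = 0"
    "\<And>x. x - (\<Sum>b\<in>D. scale (c b x) b) \<in> I"
proof -
  obtain B where B: "finite B" "span (I \<union> B) = UNIV"
    using assms finite_codim_iff by blast
  obtain E where E: "E \<subseteq> I" "independent E" "I \<subseteq> span E"
    using maximal_independent_subset by blast
  have spanE: "span E = I"
    using E I by (meson span_minimal subset_antisym)
  obtain F where F: "E \<subseteq> F" "F \<subseteq> E \<union> B" "independent F" "E \<union> B \<subseteq> span F"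
    using maximal_independent_subset_extend[of E "E \<union> B"] E(2) by blast
  have "I \<union> B \<subseteq> span F"
    using F E by (meson Un_subset_iff order_trans span_mono)
  then have UNIV: "x \<in> span F" for x
    using B(2) by (metis UNIV_I span_minimal subspace_span subsetD)
  show thesis
  proof (rule that[of "F - E" "\<lambda>b x. representation F x b"])
    show "finite (F - E)"
      using F(2) B(1) by (meson Diff_subset_conv finite_subset)
    show "(\<lambda>x. representation F x b) \<in> dual scale" for b
      using UNIV by (simp add: dual_iff representation_add representation_scale F(3))
    show "representation F x b = 0" if "b \<in> F - E" "x \<in> I" for b x
    proof -
      \<comment> \<open>An element of \<open>I\<close> has the same coordinates over
        \<open>F\<close> as over \<open>E\<close>, hence none at vectors outside
        \<open>E\<close>.\<close>
      have "representation F x = representation E x"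
        using that spanE F by (intro representation_extend) auto
      then show ?thesis
        using that representation_ne_zero[of E x b] by auto
    qed
    fix x
    let ?r = "representation F x" and ?S = "{b. representation F x b \<noteq> 0}"
    have fin: "finite ?S" by (rule finite_representation)
    have sub: "?S \<subseteq> F" using representation_ne_zero by blast
    have "x = (\<Sum>b\<in>?S. scale (?r b) b)"
      using sum_nonzero_representation_eq[OF F(3) UNIV] by simp
    \<comment> \<open>The terms at vectors of \<open>E\<close> add up to an element of
      \<open>I\<close>; the others become the sum over \<open>F - E\<close> once zero terms are
      included.\<close>
    also have "\<dots> = (\<Sum>b\<in>?S \<inter> E. scale (?r b) b) + (\<Sum>b\<in>?S - E. scale (?r b) b)"
      using fin by (rule sum.Int_Diff)
    also have "(\<Sum>b\<in>?S - E. scale (?r b) b) = (\<Sum>b\<in>F - E. scale (?r b) b)"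
      using sub \<open>finite (F - E)\<close> by (intro sum.mono_neutral_left) auto
    finally have "x - (\<Sum>b\<in>F - E. scale (?r b) b) = (\<Sum>b\<in>?S \<inter> E. scale (?r b) b)"
      unfolding diff_eq_eq .
    also have "\<dots> \<in> I"
      using E(1) I by (intro subspace_sum subspace_scale) auto
    finally show "x - (\<Sum>b\<in>F - E. scale (?r b) b) \<in> I" .
  qed
qed

text \<open>Induction on \<open>L\<close>: imposing one more functional costs at most one more
  spanning vector.\<close>

lemma (in vector_space) finite_codim_common_kernel:
  assumes "finite L" "L \<subseteq> dual scale"
  shows "\<exists>B. finite B \<and> span ({x. \<forall>f\<in>L. f x = 0} \<union> B) = UNIV"
  using assms
proof (induction L rule: finite_induct)
  case empty
  then show ?case by (intro exI[of _ "{}"]) simp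
next
  case (insert f L)
  let ?K = "\<lambda>L. {x. \<forall>f\<in>L. f x = 0}"
  obtain B where B: "finite B" "span (?K L \<union> B) = UNIV"
    using insert by auto
  show ?case
  proof (cases "\<exists>k\<in>?K L. f k \<noteq> 0")
    case False
    then have "?K (insert f L) = ?K L" by auto
    then show ?thesis using B by auto
  next
    case True
    then obtain k where k: "\<forall>g\<in>L. g k = 0" "f k \<noteq> 0" by blast
    \<comment> \<open>The new vector is \<open>k\<close>: subtracting the multiple
      \<open>f x / f k\<close> of \<open>k\<close> from \<open>x\<close> makes \<open>f\<close>
      vanish and leaves the values of the functionals in \<open>L\<close> unchanged.\<close>
    let ?S = "span (?K (insert f L) \<union> insert k B)"
    have "?K L \<subseteq> ?S"
    proof
      fix x assume x: "x \<in> ?K L"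
      let ?c = "f x / f k"
      have diff: "g (x - scale ?c k) = g x - ?c * g k" if "g \<in> insert f L" for g
      proof -
        have "g \<in> dual scale" using that insert by blast
        then show ?thesis
          unfolding dual_iff by (metis add_diff_cancel_right' diff_add_cancel)
      qed
      have "x - scale ?c k \<in> ?K (insert f L)"
        using x k by (auto simp: diff)
      then have "x - scale ?c k \<in> ?S" "scale ?c k \<in> ?S"
        by (auto intro: span_base span_scale)
      from span_add[OF this] show "x \<in> ?S" by simp
    qed
    moreover have "B \<subseteq> ?S" by (auto intro: span_base)
    ultimately have "span (?K L \<union> B) \<subseteq> ?S"
      by (intro span_minimal) auto
    then show ?thesis using B by (intro exI[of _ "insert k B"]) auto
  qed
qed

text \<open>Each of the two subspaces contains the common kernel of finitely many functionals,
  namely its coordinates from \<open>finite_codim_dual_basis\<close>. The common kernel of both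
  families together lies in \<open>I \<inter> J\<close> and has finite codimension.\<close>

lemma (in vector_space) finite_codim_Int:
  assumes "subspace I" "finite_codim scale I" "subspace J" "finite_codim scale J"
  shows "finite_codim scale (I \<inter> J)"
proof -
  have *: "\<exists>L. finite L \<and> L \<subseteq> dual scale \<and> {x. \<forall>f\<in>L. f x = 0} \<subseteq> I"
    if I: "subspace I" "finite_codim scale I" for I
  proof -
    obtain D c where D: "finite D" "\<And>b. b \<in> D \<Longrightarrow> c b \<in> dual scale"
      "\<And>x. x - (\<Sum>b\<in>D. scale (c b x) b) \<in> I"
      using finite_codim_dual_basis[OF I] by metis
    have "x \<in> I" if "\<forall>b\<in>D. c b x = 0" for x
      using D(3)[of x] that by simp
    then show ?thesis
      using D by (intro exI[of _ "c ` D"]) auto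
  qed
  obtain L where L: "finite L" "L \<subseteq> dual scale" "{x. \<forall>f\<in>L. f x = 0} \<subseteq> I"
    using *[OF assms(1,2)] by blast
  obtain L' where L': "finite L'" "L' \<subseteq> dual scale" "{x. \<forall>f\<in>L'. f x = 0} \<subseteq> J"
    using *[OF assms(3,4)] by blast
  obtain B where B: "finite B" "span ({x. \<forall>f\<in>L \<union> L'. f x = 0} \<union> B) = UNIV"
    using finite_codim_common_kernel[of "L \<union> L'"] L(1,2) L'(1,2) by auto
  have "{x. \<forall>f\<in>L \<union> L'. f x = 0} \<union> B \<subseteq> (I \<inter> J) \<union> B"
    using L(3) L'(3) by blast
  from span_mono[OF this] have "span ((I \<inter> J) \<union> B) = UNIV"
    unfolding B(2) by blast
  then show ?thesis
    unfolding finite_codim_iff[OF subspace_inter[OF assms(1,3)]] using B(1) by blast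
qed

lemma (in vector_space) finite_codim_UNIV: "finite_codim scale UNIV"
  using finite_codim_iff[OF subspace_UNIV] by (auto intro: exI[of _ "{}"])

text \<open>The form \<open>t\<close> depends on its second argument only through finitely many
  coordinates modulo \<open>I\<close>, which makes it a finite sum of pure tensors. Both the
  comultiplication and the coaction are placed in their tensor products this way.\<close>

lemma (in vector_space) in_tensor_if_finite_codim:
  assumes I: "subspace I" "finite_codim scale I"
    and C: "\<And>c. c \<in> dual scale \<Longrightarrow> (\<And>x. x \<in> I \<Longrightarrow> c x = 0) \<Longrightarrow> c \<in> C"
    and A: "\<And>g. (\<lambda>m. t (m, g)) \<in> A"
    and t: "\<And>m. (\<lambda>g. t (m, g)) \<in> dual scale" "\<And>m a. a \<in> I \<Longrightarrow> t (m, a) = 0"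
  shows "t \<in> tensor A C"
proof -
  obtain D c where D: "finite D" "\<And>b. b \<in> D \<Longrightarrow> c b \<in> dual scale"
    "\<And>b x. b \<in> D \<Longrightarrow> x \<in> I \<Longrightarrow> c b x = 0"
    "\<And>x. x - (\<Sum>b\<in>D. scale (c b x) b) \<in> I"
    by (rule finite_codim_dual_basis[OF I]) (rule that)
  have "t (m, g) = (\<Sum>b\<in>D. t (m, b) * c b g)" for m g
  proof -
    let ?s = "\<Sum>b\<in>D. scale (c b g) b"
    have t_add: "t (m, x + y) = t (m, x) + t (m, y)" and t_scale: "t (m, scale k x) = k * t (m, x)"
      for x y k
      using t(1)[of m] by (simp_all add: dual_iff)
    \<comment> \<open>The summand \<open>g - ?s\<close> lies in \<open>I\<close>, where
      \<open>t\<close> vanishes.\<close>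
    have "t (m, g) = t (m, (g - ?s) + ?s)" by simp
    also have "\<dots> = t (m, g - ?s) + t (m, ?s)"
      by (rule t_add)
    also have "\<dots> = t (m, ?s)"
      using t(2)[OF D(4)] by simp
    also have "\<dots> = (\<Sum>b\<in>D. t (m, scale (c b g) b))"
      using dual_sum[OF t(1)] .
    also have "\<dots> = (\<Sum>b\<in>D. t (m, b) * c b g)"
      by (simp add: t_scale mult.commute)
    finally show ?thesis .
  qed
  then have "t = (\<Sum>b\<in>D. ftensor (\<lambda>m. t (m, b)) (c b))"
    unfolding fun_eq_iff split_paired_All sum_fun_apply ftensor_def prod.case by blast
  also have "\<dots> \<in> tensor A C"
    using A C D by (intro fs.subspace_sum tensor_subspace ftensor_in_tensor) auto
  finally show ?thesis .
qed

section \<open>The Sweedler dual of a Hom-algebra\<close>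

context hom_algebra
begin

lemma hom_ideal_UNIV: "hom_ideal scale mult twist UNIV"
  by (simp add: hom_ideal_def)

lemma hom_ideal_Int:
  "hom_ideal scale mult twist I \<Longrightarrow> hom_ideal scale mult twist J \<Longrightarrow>
    hom_ideal scale mult twist (I \<inter> J)"
  by (auto simp: hom_ideal_def subspace_inter)

lemma finite_codim_ideal_Int:
  assumes "hom_ideal scale mult twist I" "finite_codim scale I"
    and "hom_ideal scale mult twist J" "finite_codim scale J"
  shows "hom_ideal scale mult twist (I \<inter> J) \<and> finite_codim scale (I \<inter> J)"
  using assms hom_ideal_Int finite_codim_Int by (simp add: hom_ideal_def)

lemma sweedler_dual_iff:
  "f \<in> sweedler_dual scale mult twist \<longleftrightarrow> f \<in> dual scale \<and>
    (\<exists>J. hom_ideal scale mult twist J \<and> finite_codim scale J \<and> (\<forall>x\<in>J. f x = 0))"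
  by (auto simp: sweedler_dual_def)

text \<open>For a sum of functionals vanishing on \<open>I\<close> and \<open>J\<close>, the ideal
  \<open>I \<inter> J\<close> is the witness; for the zero functional it is the whole
  algebra.\<close>

lemma sweedler_dual_subspace: "fs.subspace (sweedler_dual scale mult twist)"
  unfolding fs.subspace_def
proof (intro conjI ballI allI)
  show "0 \<in> sweedler_dual scale mult twist"
    using fs.subspace_0[OF dual_subspace] hom_ideal_UNIV finite_codim_UNIV
    by (auto simp: sweedler_dual_iff)
next
  fix f g assume "f \<in> sweedler_dual scale mult twist" "g \<in> sweedler_dual scale mult twist"
  then obtain I J where
    "hom_ideal scale mult twist I" "finite_codim scale I" "\<forall>x\<in>I. f x = 0"
    "hom_ideal scale mult twist J" "finite_codim scale J" "\<forall>x\<in>J. g x = 0"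
    "f \<in> dual scale" "g \<in> dual scale"
    unfolding sweedler_dual_iff by blast
  then show "f + g \<in> sweedler_dual scale mult twist"
    unfolding sweedler_dual_iff
    using finite_codim_ideal_Int fs.subspace_add[OF dual_subspace]
    by (intro conjI exI[of _ "I \<inter> J"]) auto
next
  fix k f assume "f \<in> sweedler_dual scale mult twist"
  then show "fscale k f \<in> sweedler_dual scale mult twist"
    unfolding sweedler_dual_iff using fs.subspace_scale[OF dual_subspace]
    by (auto simp: fscale_def)
qed

text \<open>One ideal serves both factors. As \<open>J\<close> absorbs products on either side,
  \<open>f (mult x y)\<close> vanishes once \<open>x\<close> or \<open>y\<close> is in
  \<open>J\<close>: the case of \<open>y\<close> allows the expansion modulo \<open>J\<close>, the
  case of \<open>x\<close> puts its coefficients into the Sweedler dual.\<close>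

lemma comult_in_tensor:
  assumes "f \<in> sweedler_dual scale mult twist"
  shows "dual_map (case_prod mult) f
    \<in> tensor (sweedler_dual scale mult twist) (sweedler_dual scale mult twist)"
proof -
  obtain J where f: "f \<in> dual scale" and J: "hom_ideal scale mult twist J" "finite_codim scale J"
    "\<forall>x\<in>J. f x = 0"
    using assms unfolding sweedler_dual_iff by blast
  show ?thesis
  proof (rule in_tensor_if_finite_codim)
    show "subspace J" using J(1) by (simp add: hom_ideal_def)
    show "finite_codim scale J" by fact
    show "c \<in> sweedler_dual scale mult twist"
      if "c \<in> dual scale" "\<And>x. x \<in> J \<Longrightarrow> c x = 0" for c
      using that J unfolding sweedler_dual_iff by blast
    show "(\<lambda>x. dual_map (case_prod mult) f (x, y)) \<in> sweedler_dual scale mult twist" for y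
      using dual_map_in_dual[OF mult_linear_left f] J
      unfolding sweedler_dual_iff by (auto simp: dual_map_def o_def hom_ideal_def)
    show "(\<lambda>y. dual_map (case_prod mult) f (x, y)) \<in> dual scale" for x
      using dual_map_in_dual[OF mult_linear_right f] by (simp add: dual_map_def o_def)
    show "dual_map (case_prod mult) f (x, y) = 0" if "y \<in> J" for x y
      using that J by (auto simp: dual_map_def hom_ideal_def)
  qed
qed

lemma cotwist_in_sweedler_dual:
  assumes "f \<in> sweedler_dual scale mult twist"
  shows "dual_map twist f \<in> sweedler_dual scale mult twist"
proof -
  obtain J where f: "f \<in> dual scale" and J: "hom_ideal scale mult twist J" "finite_codim scale J"
    "\<forall>x\<in>J. f x = 0"
    using assms unfolding sweedler_dual_iff by blast
  have "f (twist x) = 0" if "x \<in> J" for x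
    using that J by (auto simp: hom_ideal_def)
  then show ?thesis
    using dual_map_in_dual[OF twist_linear f] J
    unfolding sweedler_dual_iff by (auto simp: dual_map_def)
qed

lemma hom_coalgebra_sweedler_dual:
  "hom_coalgebra (sweedler_dual scale mult twist) (dual_map (case_prod mult)) (dual_map twist)"
proof unfold_locales
  note [simp] = tensor_map_dual_map[OF sweedler_dual_subspace sweedler_dual_subspace
      comult_in_tensor]
  let ?C = "sweedler_dual scale mult twist" and ?\<Delta> = "dual_map (case_prod mult)"
  fix f assume f: "f \<in> ?C"
  \<comment> \<open>At \<open>((x, y), z)\<close> the two sides are
    \<open>f (mult (twist x) (mult y z))\<close> and
    \<open>f (mult (mult x y) (twist z))\<close>.\<close>
  show "tensor_assoc (tensor_map ?C ?C (dual_map twist) ?\<Delta> (?\<Delta> f)) =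
      tensor_map ?C ?C ?\<Delta> (dual_map twist) (?\<Delta> f)"
    using f by simp (auto simp: tensor_assoc_def dual_map_def fun_eq_iff hom_assoc)
  show "?\<Delta> (dual_map twist f) = tensor_map ?C ?C (dual_map twist) (dual_map twist) (?\<Delta> f)"
    using f by simp (auto simp: dual_map_def fun_eq_iff twist_mult)
qed (auto simp: sweedler_dual_subspace linear_on_dual_map comult_in_tensor
      cotwist_in_sweedler_dual)

end

section \<open>The Sweedler dual of a right Hom-module\<close>

context right_hom_module
begin

abbreviation "GD \<equiv> sweedler_dual scaleG mult twist"
abbreviation "MD \<equiv> sweedler_dual_module scaleG mult twist scaleM act"

text \<open>The kernel of a linear functional is a subspace, so vanishing on the generators
  \<open>act m a\<close> already gives vanishing on their span.\<close>

lemma sweedler_dual_module_iff: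
  "f \<in> MD \<longleftrightarrow> f \<in> dual scaleM \<and> (\<exists>I. hom_ideal scaleG mult twist I \<and>
    finite_codim scaleG I \<and> (\<forall>m. \<forall>a\<in>I. f (act m a) = 0))"
proof -
  have "(\<forall>x \<in> M.span {act m a | m a. a \<in> I}. f x = 0) \<longleftrightarrow> (\<forall>m. \<forall>a\<in>I. f (act m a) = 0)"
    if "f \<in> dual scaleM" for I
    using M.span_minimal[OF _ M.subspace_kernel_dual[OF that], of "{act m a | m a. a \<in> I}"]
      M.span_base[of _ "{act m a | m a. a \<in> I}"] by blast
  then show ?thesis
    unfolding sweedler_dual_module_def by auto
qed

lemma sweedler_dual_module_subspace: "fs.subspace MD"
  unfolding fs.subspace_def
proof (intro conjI ballI allI)
  show "0 \<in> MD"
    using fs.subspace_0[OF M.dual_subspace] hom_ideal_UNIV finite_codim_UNIV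
    by (auto simp: sweedler_dual_module_iff)
next
  fix f g assume "f \<in> MD" "g \<in> MD"
  then obtain I J where
    "hom_ideal scaleG mult twist I" "finite_codim scaleG I" "\<forall>m. \<forall>a\<in>I. f (act m a) = 0"
    "hom_ideal scaleG mult twist J" "finite_codim scaleG J" "\<forall>m. \<forall>a\<in>J. g (act m a) = 0"
    "f \<in> dual scaleM" "g \<in> dual scaleM"
    unfolding sweedler_dual_module_iff by blast
  then show "f + g \<in> MD"
    unfolding sweedler_dual_module_iff
    using finite_codim_ideal_Int fs.subspace_add[OF M.dual_subspace]
    by (intro conjI exI[of _ "I \<inter> J"]) auto
next
  fix k f assume "f \<in> MD"
  then show "fscale k f \<in> MD"
    unfolding sweedler_dual_module_iff using fs.subspace_scale[OF M.dual_subspace]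
    by (auto simp: fscale_def)
qed

lemma coact_in_tensor:
  assumes "surj twist" "f \<in> MD"
  shows "dual_map (case_prod act) f \<in> tensor MD GD"
proof -
  obtain I where f: "f \<in> dual scaleM" and I: "hom_ideal scaleG mult twist I"
    "finite_codim scaleG I" "\<forall>m. \<forall>a\<in>I. f (act m a) = 0"
    using assms unfolding sweedler_dual_module_iff by blast
  show ?thesis
  proof (rule in_tensor_if_finite_codim)
    show "subspace I" using I(1) by (simp add: hom_ideal_def)
    show "finite_codim scaleG I" by fact
    show "c \<in> GD" if "c \<in> dual scaleG" "\<And>x. x \<in> I \<Longrightarrow> c x = 0" for c
      using that I unfolding sweedler_dual_iff by blast
    show "(\<lambda>m. dual_map (case_prod act) f (m, g)) \<in> MD" for g
    proof -
      \<comment> \<open>Surjectivity of \<open>twist\<close> enters here. It makes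
        \<open>act_assoc\<close> applicable with an arbitrary \<open>g\<close> as the outer factor,
        so every slice of the coaction is annihilated by the same ideal \<open>I\<close>.\<close>
      obtain h where "g = twist h" using assms(1) by blast
      then have "f (act (act m a) g) = 0" if "a \<in> I" for m a
        using that I act_assoc by (simp add: hom_ideal_def)
      then show ?thesis
        using M.dual_map_in_dual[OF act_linear_left f] I
        unfolding sweedler_dual_module_iff by (auto simp: dual_map_def o_def)
    qed
    show "(\<lambda>g. dual_map (case_prod act) f (m, g)) \<in> dual scaleG" for m
      using M.dual_map_in_dual[OF act_linear_right f] by (simp add: dual_map_def o_def)
    show "dual_map (case_prod act) f (m, a) = 0" if "a \<in> I" for m a
      using that I by (simp add: dual_map_def)
  qed
qed

lemma cotwist_in_sweedler_dual_module:
  assumes "f \<in> MD"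
  shows "dual_map twistM f \<in> MD"
proof -
  obtain I where f: "f \<in> dual scaleM" and I: "hom_ideal scaleG mult twist I"
    "finite_codim scaleG I" "\<forall>m. \<forall>a\<in>I. f (act m a) = 0"
    using assms unfolding sweedler_dual_module_iff by blast
  \<comment> \<open>Read backwards, \<open>act_twist\<close> gives
    \<open>act (twistM m) (twist a)\<close>, and \<open>twist a\<close> is again in
    \<open>I\<close>.\<close>
  have "f (twistM (act m a)) = 0" if "a \<in> I" for m a
    using that I by (auto simp: hom_ideal_def simp flip: act_twist)
  then show ?thesis
    using M.dual_map_in_dual[OF twistM_linear f] I
    unfolding sweedler_dual_module_iff by (auto simp: dual_map_def)
qed

lemma right_hom_comodule_sweedler_dual:
  assumes "surj twist"
  shows "right_hom_comodule GD (dual_map (case_prod mult)) (dual_map twist)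
    MD (dual_map (case_prod act)) (dual_map twistM)"
proof -
  \<comment> \<open>This supplies the coalgebra half of the comodule axioms.\<close>
  interpret C: hom_coalgebra GD "dual_map (case_prod mult)" "dual_map twist"
    by (rule hom_coalgebra_sweedler_dual)
  note [simp] = tensor_map_dual_map[OF sweedler_dual_module_subspace sweedler_dual_subspace
      coact_in_tensor[OF assms]]
  let ?\<phi> = "dual_map (case_prod act)"
  show ?thesis
  proof unfold_locales
    fix f assume f: "f \<in> MD"
    \<comment> \<open>At \<open>((m, g), h)\<close> this reads
      \<open>f (act (act m g) (twist h)) = f (act (twistM m) (mult g h))\<close>.\<close>
    show "tensor_map MD GD ?\<phi> (dual_map twist) (?\<phi> f) =
        tensor_assoc (tensor_map MD GD (dual_map twistM) (dual_map (case_prod mult)) (?\<phi> f))"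
      using f by simp (auto simp: tensor_assoc_def dual_map_def fun_eq_iff act_assoc)
    \<comment> \<open>At \<open>(m, g)\<close> this reads
      \<open>f (act (twistM m) (twist g)) = f (twistM (act m g))\<close>.\<close>
    show "tensor_map MD GD (dual_map twistM) (dual_map twist) (?\<phi> f) = ?\<phi> (dual_map twistM f)"
      using f by simp (auto simp: dual_map_def fun_eq_iff act_twist)
  qed (auto simp: sweedler_dual_module_subspace linear_on_dual_map coact_in_tensor[OF assms]
      cotwist_in_sweedler_dual_module)
qed

end

theorem theorem4:
  fixes scaleG :: "'k::field_char_0 \<Rightarrow> 'g::ab_group_add \<Rightarrow> 'g"
    and \<mu> :: "'g \<Rightarrow> 'g \<Rightarrow> 'g" and \<alpha> :: "'g \<Rightarrow> 'g"
    and scaleM :: "'k \<Rightarrow> 'm::ab_group_add \<Rightarrow> 'm"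
    and \<psi> :: "'m \<Rightarrow> 'g \<Rightarrow> 'm" and \<gamma> :: "'m \<Rightarrow> 'm"
  assumes "hom_algebra scaleG \<mu> \<alpha>"
    and "bij \<alpha>"
    and "right_hom_module scaleG \<mu> \<alpha> scaleM \<psi> \<gamma>"
  shows "right_hom_comodule
           (sweedler_dual scaleG \<mu> \<alpha>) (dual_map (case_prod \<mu>)) (dual_map \<alpha>)
           (sweedler_dual_module scaleG \<mu> \<alpha> scaleM \<psi>) (dual_map (case_prod \<psi>)) (dual_map \<gamma>)"
  using right_hom_module.right_hom_comodule_sweedler_dual[OF assms(3) bij_is_surj[OF assms(2)]] .

end
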